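(* Let $(\xi_n)_{n=0}^\infty$ be a sequence of arbitrary random variables on a probability space $(\Omega,\mathcal{F},\mathbb{P})$ taking values in the finite set $\mathbf{X}=\{1,2,\ldots,b\}$. Let $(a_n)_{n=0}^\infty$ and $(\phi(n))_{n=0}^\infty$ be two sequences of nonnegative integers such that $\phi(n)\to\infty$ as $n\to\infty$, and let $$f_{a_n,\phi(n)}(\omega)=-\frac{1}{\phi(n)}\log p(\xi_{a_n},\xi_{a_n+1},\ldots,\xi_{a_n+\phi(n)}).$$ Then the random variables $f_{a_n,\phi(n)}(\omega)$ are uniformly integrable (in $n$).
   Context: $\log$ is the natural logarithm. For nonnegative integers $m,n$ and $x_m,\ldots,x_{m+n}\in\mathbf{X}$, $p(x_m,\ldots,x_{m+n})=\mathbb{P}(\xi_m=x_m,\ldots,\xi_{m+n}=x_{m+n})$ denotes the joint distribution of $(\xi_m,\ldots,\xi_{m+n})$; thus $p(\xi_{a_n},\ldots,\xi_{a_n+\phi(n)})$ is this function evaluated at the random vector itself. The quantity $f_{a_n,\phi(n)}$ is considered for those $n$ with $\phi(n)\ge 1$, where it is defined. *)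

theory Defs
  imports "HOL-Probability.Probability"
begin

text \<open>
  Uniform integrability of the family \<open>(X i)\<close> for \<open>i \<in> I\<close>:
  the supremum over \<open>i \<in> I\<close> of \<open>E[\<bar>X i\<bar>; \<bar>X i\<bar> \<ge> K]\<close> tends to \<open>0\<close> as \<open>K \<rightarrow> \<infinity>\<close>.
  The expectations are taken in \<open>ennreal\<close>, so that infinite expectations and an infinite supremum
  are not confused with the default value of the Bochner integral or of the real-valued supremum.
\<close>

definition uniformly_integrable :: "'a measure \<Rightarrow> 'i set \<Rightarrow> ('i \<Rightarrow> 'a \<Rightarrow> real) \<Rightarrow> bool" where
  "uniformly_integrable M I X \<longleftrightarrow>
     (\<forall>i\<in>I. X i \<in> borel_measurable M) \<and>
     ((\<lambda>K::real. SUP i\<in>I. \<integral>\<^sup>+\<omega>. ennreal \<bar>X i \<omega>\<bar> * indicator {\<omega>. K \<le> \<bar>X i \<omega>\<bar>} \<omega> \<partial>M)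
        \<longlongrightarrow> 0) at_top"

text \<open>
  The joint distribution \<open>p(x\<^sub>m, \<dots>, x\<^bsub>m+n\<^esub>)\<close> of \<open>(\<xi>\<^sub>m, \<dots>, \<xi>\<^bsub>m+n\<^esub>)\<close>. The argument \<open>x\<close> is a whole
  sequence, of which only the entries with index in \<open>{m..m+n}\<close> matter.
\<close>

definition joint_prob ::
  "'a measure \<Rightarrow> (nat \<Rightarrow> 'a \<Rightarrow> 'b) \<Rightarrow> nat \<Rightarrow> nat \<Rightarrow> (nat \<Rightarrow> 'b) \<Rightarrow> real" where
  "joint_prob M \<xi> m n x = measure M {\<omega> \<in> space M. \<forall>k\<in>{m..m+n}. \<xi> k \<omega> = x k}"

text \<open>
  The points \<open>\<omega>\<close> at which the probability below vanishes form a null set if the \<open>\<xi> k\<close> take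
  finitely many values; there the convention \<open>ln 0 = 0\<close> gives the value \<open>0\<close>.
\<close>

definition sample_entropy ::
  "'a measure \<Rightarrow> (nat \<Rightarrow> 'a \<Rightarrow> 'b) \<Rightarrow> nat \<Rightarrow> nat \<Rightarrow> 'a \<Rightarrow> real" where
  "sample_entropy M \<xi> m n \<omega> = - (1 / real n) * ln (joint_prob M \<xi> m n (\<lambda>k. \<xi> k \<omega>))"

end

theory Submission
  imports Defs "HOL-Real_Asymp.Real_Asymp"
begin

text \<open>
  A word of length \<open>n + 1\<close> whose normalized information content \<open>t = - ln p / n\<close> is at least \<open>K\<close>
  contributes \<open>t p = t exp (- n t) \<le> 2 exp (- n t / 2) \<le> 2 exp (- n K / 2)\<close> to the tail expectation.
  There are at most \<open>b ^ (n + 1) \<le> (b\<^sup>2) ^ n\<close> words, so the tail expectation is at most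
  \<open>2 (b\<^sup>2 exp (- K / 2)) ^ n\<close>. Once \<open>b\<^sup>2 exp (- K / 2) \<le> 1\<close>, this is at most
  \<open>2 b\<^sup>2 exp (- K / 2)\<close>, uniformly in \<open>n \<ge> 1\<close>.
\<close>

lemma normalized_information_tail_le:
  fixes p K :: real and n :: nat
  assumes "0 \<le> p" "p \<le> 1" "n \<ge> 1"
  defines "t \<equiv> \<bar>- (1 / real n) * ln p\<bar>"
  shows "(if K \<le> t then t else 0) * p \<le> 2 * exp (- (real n * K / 2))"
proof (cases "p > 0 \<and> K \<le> t")
  case True
  then have "ln p \<le> 0" using assms(2) by simp
  then have t: "t = - ln p / real n" and t0: "t \<ge> 0"
    unfolding t_def by (simp_all add: abs_mult divide_simps)
  have p: "p = exp (- (real n * t))" using True assms(3) t by simp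
  \<comment> \<open>Half of the exponent \<open>n * t\<close> is spent on absorbing the factor
    \<open>t\<close>, using \<open>n \<ge> 1\<close>; the other half remains as decay.\<close>
  have "t / 2 \<le> exp (t / 2)" using exp_ge_add_one_self[of "t / 2"] by linarith
  also have "\<dots> \<le> exp (real n * t / 2)"
    using mult_right_mono[of 1 "real n" t] t0 assms(3) by simp
  finally have "t * p \<le> 2 * exp (real n * t / 2) * exp (- (real n * t))"
    unfolding p by (intro mult_right_mono) auto
  also have "\<dots> = 2 * exp (- (real n * t / 2))"
    by (simp flip: exp_add)
  also have "\<dots> \<le> 2 * exp (- (real n * K / 2))"
    using True by (simp add: mult_left_mono)
  finally show ?thesis using True by simp
next
  case False
  \<comment> \<open>The left side is 0: either the cutoff fails, or \<open>p = 0\<close> and the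
    factor \<open>p\<close> removes whatever value \<open>ln\<close> takes there.\<close>
  then show ?thesis using assms(1) by auto
qed

lemma joint_prob_cong:
  assumes "\<And>k. k \<in> {m..m+n} \<Longrightarrow> x k = y k"
  shows "joint_prob M \<xi> m n x = joint_prob M \<xi> m n y"
  unfolding joint_prob_def using assms by (intro arg_cong[where f = "measure M"]) auto

text \<open>The word events partition the space, so exactly one summand survives at each sample
  point. Extensionality of the functions in \<open>I \<rightarrow>\<^sub>E S\<close> makes the
  observed word unique.\<close>

lemma sum_indicator_word:
  fixes F :: "('i \<Rightarrow> 'b) \<Rightarrow> 'c :: semiring_1"
  assumes "finite I" "finite S" "\<omega> \<in> space M" "\<And>k. k \<in> I \<Longrightarrow> \<xi> k \<omega> \<in> S"
  shows "(\<Sum>x\<in>I \<rightarrow>\<^sub>E S. F x * indicator {\<omega> \<in> space M. \<forall>k\<in>I. \<xi> k \<omega> = x k} \<omega>)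
       = F (restrict (\<lambda>k. \<xi> k \<omega>) I)"
proof -
  let ?y = "restrict (\<lambda>k. \<xi> k \<omega>) I"
  have "(\<Sum>x\<in>I \<rightarrow>\<^sub>E S. F x * indicator {\<omega> \<in> space M. \<forall>k\<in>I. \<xi> k \<omega> = x k} \<omega>)
      = (\<Sum>x\<in>I \<rightarrow>\<^sub>E S. if x = ?y then F x else 0)"
  proof (intro sum.cong refl)
    fix x assume x: "x \<in> I \<rightarrow>\<^sub>E S"
    have "(\<forall>k\<in>I. \<xi> k \<omega> = x k) \<longleftrightarrow> x = ?y"
      using x by (auto simp: fun_eq_iff PiE_def extensional_def)
    then show "F x * indicator {\<omega> \<in> space M. \<forall>k\<in>I. \<xi> k \<omega> = x k} \<omega> = (if x = ?y then F x else 0)"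
      using assms(3) by (simp add: indicator_def)
  qed
  also have "\<dots> = F ?y"
    using assms by (subst sum.delta) (auto intro: finite_PiE)
  finally show ?thesis .
qed

context prob_space
begin

context
  fixes \<xi> :: "nat \<Rightarrow> 'a \<Rightarrow> 'b" and S :: "'b set"
  assumes \<xi>[measurable]: "\<And>n. \<xi> n \<in> measurable M (count_space S)"
    and S: "finite S"
begin

lemma word_event_sets: "{\<omega> \<in> space M. \<forall>k\<in>{m..m+n::nat}. \<xi> k \<omega> = x k} \<in> sets M"
proof (intro sets.sets_Collect_finite_All')
  fix k
  \<comment> \<open>The letter \<open>x k\<close> may lie outside \<open>S\<close>, while only
    subsets of \<open>S\<close> are measurable in \<open>count_space S\<close>; hence the
    intersection.\<close>
  have "{\<omega> \<in> space M. \<xi> k \<omega> = x k} = \<xi> k -` ({x k} \<inter> S) \<inter> space M"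
    using measurable_space[OF \<xi>[of k]] by auto
  also have "\<dots> \<in> sets M" by (rule measurable_sets[OF \<xi>]) auto
  finally show "{\<omega> \<in> space M. \<xi> k \<omega> = x k} \<in> sets M" .
qed auto

text \<open>Turns any function of the random word probability into a finite combination of
  indicators. The type of the values is left general: real values serve measurability,
  \<open>ennreal\<close> values the tail integral.\<close>

lemma sum_indicator_joint_prob:
  fixes G :: "real \<Rightarrow> 'c :: semiring_1"
  assumes "\<omega> \<in> space M"
  shows "(\<Sum>x\<in>{m..m+n} \<rightarrow>\<^sub>E S. G (joint_prob M \<xi> m n x)
            * indicator {\<omega> \<in> space M. \<forall>k\<in>{m..m+n}. \<xi> k \<omega> = x k} \<omega>)
       = G (joint_prob M \<xi> m n (\<lambda>k. \<xi> k \<omega>))"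
proof -
  have "joint_prob M \<xi> m n (restrict (\<lambda>k. \<xi> k \<omega>) {m..m+n}) = joint_prob M \<xi> m n (\<lambda>k. \<xi> k \<omega>)"
    by (rule joint_prob_cong) auto
  then show ?thesis
    using sum_indicator_word[where F = "\<lambda>x. G (joint_prob M \<xi> m n x)" and \<xi> = \<xi> and I = "{m..m+n}"]
      assms S measurable_space[OF \<xi>] by simp
qed

lemma borel_measurable_sample_entropy: "sample_entropy M \<xi> m n \<in> borel_measurable M"
proof -
  have "(\<lambda>\<omega>. \<Sum>x\<in>{m..m+n} \<rightarrow>\<^sub>E S. - (1 / real n) * ln (joint_prob M \<xi> m n x)
      * indicator {\<omega> \<in> space M. \<forall>k\<in>{m..m+n}. \<xi> k \<omega> = x k} \<omega>) \<in> borel_measurable M"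
    using word_event_sets by (intro borel_measurable_sum borel_measurable_times) auto
  then show ?thesis
    by (rule measurable_cong[THEN iffD1, rotated])
      (subst sum_indicator_joint_prob[where G = "\<lambda>p. - (1 / real n) * ln p"],
        simp_all add: sample_entropy_def)
qed

text \<open>The bound is twice the \<open>n\<close>-th power of a ratio that is free of
  \<open>n\<close> and \<open>m\<close>, so a single \<open>K\<close> pushing the ratio below 1
  serves all windows at once.\<close>

lemma nn_integral_sample_entropy_tail_le:
  assumes n: "n \<ge> 1"
  shows "(\<integral>\<^sup>+\<omega>. ennreal \<bar>sample_entropy M \<xi> m n \<omega>\<bar>
            * indicator {\<omega>. K \<le> \<bar>sample_entropy M \<xi> m n \<omega>\<bar>} \<omega> \<partial>M)
         \<le> ennreal (2 * ((real (card S))\<^sup>2 * exp (- (K / 2))) ^ n)"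
proof -
  let ?c = "real (card S)"
  define t where "t p = \<bar>- (1 / real n) * ln p\<bar>" for p
  \<comment> \<open>The tail indicator is absorbed into \<open>g\<close>, so the integrand depends
    on the path only through its word probability.\<close>
  define g where "g p = (if K \<le> t p then t p else 0)" for p
  have g0: "g p \<ge> 0" for p by (simp add: g_def t_def)
  let ?A = "\<lambda>x. {\<omega> \<in> space M. \<forall>k\<in>{m..m+n}. \<xi> k \<omega> = x k}"
  let ?P = "{m..m+n} \<rightarrow>\<^sub>E S"
  have "(\<integral>\<^sup>+\<omega>. ennreal \<bar>sample_entropy M \<xi> m n \<omega>\<bar>
            * indicator {\<omega>. K \<le> \<bar>sample_entropy M \<xi> m n \<omega>\<bar>} \<omega> \<partial>M)
      = (\<integral>\<^sup>+\<omega>. (\<Sum>x\<in>?P. ennreal (g (joint_prob M \<xi> m n x)) * indicator (?A x) \<omega>) \<partial>M)"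
    by (intro nn_integral_cong)
      (subst sum_indicator_joint_prob[where G = "\<lambda>p. ennreal (g p)"],
        simp_all add: g_def t_def sample_entropy_def)
  also have "\<dots> = (\<Sum>x\<in>?P. ennreal (g (joint_prob M \<xi> m n x)) * emeasure M (?A x))"
    using word_event_sets by (subst nn_integral_sum) (auto intro!: sum.cong nn_integral_cmult_indicator)
  also have "\<dots> \<le> (\<Sum>x\<in>?P. ennreal (2 * exp (- (real n * K / 2))))"
  proof (rule sum_mono)
    fix x
    have "g (joint_prob M \<xi> m n x) * joint_prob M \<xi> m n x \<le> 2 * exp (- (real n * K / 2))"
      unfolding g_def t_def using n
      by (intro normalized_information_tail_le) (auto simp: joint_prob_def)
    \<comment> \<open>The measure of the word event is the very probability at which
      \<open>g\<close> is evaluated, so the product has the form \<open>g p * p\<close>.\<close>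
    then show "ennreal (g (joint_prob M \<xi> m n x)) * emeasure M (?A x)
        \<le> ennreal (2 * exp (- (real n * K / 2)))"
      by (simp add: emeasure_eq_measure joint_prob_def g0 ennreal_leI flip: ennreal_mult)
  qed
  also have "\<dots> = ennreal (?c ^ (n + 1) * (2 * exp (- (real n * K / 2))))"
    by (simp add: card_PiE S ennreal_of_nat_eq_real_of_nat flip: ennreal_mult)
  also have "\<dots> \<le> ennreal ((?c\<^sup>2) ^ n * (2 * exp (- (real n * K / 2))))"
  proof (intro ennreal_leI mult_right_mono)
    \<comment> \<open>A window has \<open>n + 1\<close> letters, and
      \<open>n + 1 \<le> 2 * n\<close> because \<open>n \<ge> 1\<close>. Monotonicity in the
      exponent needs a base of at least 1, so the empty alphabet is treated apart.\<close>
    show "?c ^ (n + 1) \<le> (?c\<^sup>2) ^ n"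
    proof (cases "card S = 0")
      case True
      then show ?thesis using n by (simp add: zero_power)
    next
      case False
      then have "1 \<le> ?c" by linarith
      then show ?thesis
        unfolding power_mult[symmetric] using n by (intro power_increasing) auto
    qed
  qed simp
  also have "(?c\<^sup>2) ^ n * (2 * exp (- (real n * K / 2))) = 2 * (?c\<^sup>2 * exp (- (K / 2))) ^ n"
    by (simp add: power_mult_distrib flip: exp_of_nat_mult)
  finally show ?thesis .
qed

end

end

theorem lemma3:
  fixes M :: "'a measure" and \<xi> :: "nat \<Rightarrow> 'a \<Rightarrow> nat" and b :: nat
    and a \<phi> :: "nat \<Rightarrow> nat"
  assumes "prob_space M"
    and "\<And>n. \<xi> n \<in> measurable M (count_space {1..b})"
    and "filterlim \<phi> at_top sequentially"
  shows "uniformly_integrable M {n. \<phi> n \<ge> 1} (\<lambda>n. sample_entropy M \<xi> (a n) (\<phi> n))"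
proof -
  interpret prob_space M by fact
  let ?r = "\<lambda>K. (real b)\<^sup>2 * exp (- (K / 2))"
  let ?T = "\<lambda>K. SUP n\<in>{n. \<phi> n \<ge> 1}. \<integral>\<^sup>+\<omega>. ennreal \<bar>sample_entropy M \<xi> (a n) (\<phi> n) \<omega>\<bar>
              * indicator {\<omega>. K \<le> \<bar>sample_entropy M \<xi> (a n) (\<phi> n) \<omega>\<bar>} \<omega> \<partial>M"
  have lim: "(?r \<longlongrightarrow> 0) at_top" by real_asymp
  have "\<forall>\<^sub>F K in at_top. ?T K \<le> ennreal (2 * ?r K)"
    using order_tendstoD(2)[OF lim zero_less_one]
  proof eventually_elim
    case (elim K)
    show ?case
    proof (rule SUP_least)
      fix n assume "n \<in> {n. \<phi> n \<ge> 1}"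
      then have n: "\<phi> n \<ge> 1" by simp
      \<comment> \<open>The ratio lies in [0, 1), so its powers are largest at exponent 1; this
        removes the dependence on \<open>n\<close>.\<close>
      have "?r K ^ \<phi> n \<le> ?r K ^ 1"
        using elim n by (intro power_decreasing) auto
      then have le: "ennreal (2 * ?r K ^ \<phi> n) \<le> ennreal (2 * ?r K)"
        by (intro ennreal_leI) simp
      show "(\<integral>\<^sup>+\<omega>. ennreal \<bar>sample_entropy M \<xi> (a n) (\<phi> n) \<omega>\<bar>
          * indicator {\<omega>. K \<le> \<bar>sample_entropy M \<xi> (a n) (\<phi> n) \<omega>\<bar>} \<omega> \<partial>M) \<le> ennreal (2 * ?r K)"
        \<comment> \<open>Resolving with \<open>assms(2)\<close> leaves an arbitrary reindexing of
          the process open; the identity \<open>\<lambda>k. k\<close> fixes it.\<close>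
        using nn_integral_sample_entropy_tail_le[OF assms(2) _ n, of "\<lambda>k. k" "a n" K]
        by (intro order_trans[OF _ le]) simp
    qed
  qed
  moreover have "((\<lambda>K. ennreal (2 * ?r K)) \<longlongrightarrow> 0) at_top"
    using tendsto_ennrealI[OF tendsto_mult_right_zero[OF lim, of 2]] by simp
  ultimately have "(?T \<longlongrightarrow> 0) at_top"
    by (intro tendsto_sandwich[of "\<lambda>_. 0" ?T at_top]) auto
  then show ?thesis
    unfolding uniformly_integrable_def
    using borel_measurable_sample_entropy[OF assms(2)] by simp
qed

end
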